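(* Let $n \in \mathbb{N}$. There exists a branch group $G$ containing a chain of subgroups $$G_0 \leq G_1 \leq G_2 \leq \dots \leq G_n = G$$ such that, for every $i \in \{1,\dots,n\}$, $G_{i-1}$ is a branch group that is a maximal subgroup of infinite index in $G_i$.
   Context: For a finite non-empty set $X$, $X^\ast$ is the rooted tree of finite words over $X$ (root the empty word; $u$ is joined to $ux$ for $x\in X$), and $\mathrm{Aut}(X^\ast)$ is its group of automorphisms. A subgroup $G\le\mathrm{Aut}(X^\ast)$ is spherically transitive if it acts transitively on the set $X^n$ of words of length $n$ for every $n$. The rigid vertex stabiliser $\mathrm{rist}_G(v)$ of a vertex $v$ is the subgroup of all elements of $G$ that fix every vertex outside the subtree $vX^\ast$; $\mathrm{Rist}_G(n)$ is the product of all $\mathrm{rist}_G(v)$ with $v\in X^n$. A spherically transitive group $G$ is a branch group if $\mathrm{Rist}_G(n)$ has finite index in $G$ for every $n\in\mathbb{N}$. *)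

theory Defs
  imports "HOL-Algebra.Bij" "HOL-Algebra.Coset" "HOL-Algebra.Generated_Groups"
    "HOL-Library.Sublist"
begin

definition level :: "'a set \<Rightarrow> nat \<Rightarrow> 'a list set"
  where "level X n = {w \<in> lists X. length w = n}"

text \<open>Words are extended on the right, so the subtree below \<open>v\<close> is the set of words with
  prefix \<open>v\<close>.\<close>

definition tree_adj :: "'a set \<Rightarrow> 'a list \<Rightarrow> 'a list \<Rightarrow> bool"
  where "tree_adj X u w \<longleftrightarrow> (\<exists>x\<in>X. w = u @ [x]) \<or> (\<exists>x\<in>X. u = w @ [x])"

definition tree_aut :: "'a set \<Rightarrow> ('a list \<Rightarrow> 'a list) set"
  where "tree_aut X = {f \<in> Bij (lists X). f [] = [] \<and>
    (\<forall>u\<in>lists X. \<forall>w\<in>lists X. tree_adj X (f u) (f w) \<longleftrightarrow> tree_adj X u w)}"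

definition tree_Aut :: "'a set \<Rightarrow> ('a list \<Rightarrow> 'a list) monoid"
  where "tree_Aut X = BijGroup (lists X) \<lparr>carrier := tree_aut X\<rparr>"

lemma subgroup_tree_aut: "subgroup (tree_aut X) (BijGroup (lists X))"
proof (rule group.subgroupI[OF group_BijGroup])
  show "tree_aut X \<subseteq> carrier (BijGroup (lists X))"
    by (auto simp: tree_aut_def BijGroup_def)
  have "(\<lambda>x\<in>lists X. x) \<in> tree_aut X"
    by (auto simp: tree_aut_def id_Bij)
  then show "tree_aut X \<noteq> {}" by blast
next
  fix f assume "f \<in> tree_aut X"
  then have f: "f \<in> Bij (lists X)" "f [] = []"
    and adj: "\<And>u w. u \<in> lists X \<Longrightarrow> w \<in> lists X \<Longrightarrow> tree_adj X (f u) (f w) \<longleftrightarrow> tree_adj X u w"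
    by (auto simp: tree_aut_def)
  let ?g = "inv_into (lists X) f"
  have bij: "bij_betw f (lists X) (lists X)" using f(1) by (simp add: Bij_def)
  have g: "?g u \<in> lists X" "f (?g u) = u" if "u \<in> lists X" for u
    using Bij_inv_into_mem[OF f(1) that] bij_betw_inv_into_right[OF bij that] by auto
  have "?g [] = []"
    using bij_betw_inv_into_left[OF bij, of "[]"] f(2) by simp
  moreover have "tree_adj X (?g u) (?g w) \<longleftrightarrow> tree_adj X u w"
    if "u \<in> lists X" "w \<in> lists X" for u w
    using adj[OF g(1)[OF that(1)] g(1)[OF that(2)]] g(2)[OF that(1)] g(2)[OF that(2)] by simp
  ultimately show "inv\<^bsub>BijGroup (lists X)\<^esub> f \<in> tree_aut X"
    using restrict_inv_into_Bij[OF f(1)] by (simp add: inv_BijGroup[OF f(1)] tree_aut_def)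
next
  fix f g assume fg: "f \<in> tree_aut X" "g \<in> tree_aut X"
  then have B: "f \<in> Bij (lists X)" "g \<in> Bij (lists X)" by (auto simp: tree_aut_def)
  then have gX: "g u \<in> lists X" if "u \<in> lists X" for u
    using Bij_imp_funcset that by blast
  have "compose (lists X) f g \<in> tree_aut X"
    using fg gX compose_Bij[OF B] by (simp add: tree_aut_def compose_eq)
  then show "f \<otimes>\<^bsub>BijGroup (lists X)\<^esub> g \<in> tree_aut X"
    using B by (simp add: BijGroup_def)
qed

lemma group_tree_Aut: "group (tree_Aut X)"
  unfolding tree_Aut_def
  by (rule group.subgroup_imp_group[OF group_BijGroup subgroup_tree_aut])

abbreviation sub_Aut :: "'a set \<Rightarrow> ('a list \<Rightarrow> 'a list) set \<Rightarrow> ('a list \<Rightarrow> 'a list) monoid"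
  where "sub_Aut X G \<equiv> tree_Aut X \<lparr>carrier := G\<rparr>"

definition spherically_transitive :: "'a set \<Rightarrow> ('a list \<Rightarrow> 'a list) set \<Rightarrow> bool"
  where "spherically_transitive X G \<longleftrightarrow>
    (\<forall>n. \<forall>u\<in>level X n. \<forall>w\<in>level X n. \<exists>g\<in>G. g u = w)"

definition rist :: "'a set \<Rightarrow> ('a list \<Rightarrow> 'a list) set \<Rightarrow> 'a list \<Rightarrow> ('a list \<Rightarrow> 'a list) set"
  where "rist X G v = {g \<in> G. \<forall>u\<in>lists X. \<not> prefix v u \<longrightarrow> g u = u}"

text \<open>Rigid stabilisers of distinct vertices of one level commute elementwise and there are finitely
  many of them, so their product is the subgroup they generate.\<close>

definition Rist :: "'a set \<Rightarrow> ('a list \<Rightarrow> 'a list) set \<Rightarrow> nat \<Rightarrow> ('a list \<Rightarrow> 'a list) set"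
  where "Rist X G n = generate (sub_Aut X G) (\<Union>v\<in>level X n. rist X G v)"

definition finite_index :: "'b set \<Rightarrow> ('b, 'c) monoid_scheme \<Rightarrow> bool"
  where "finite_index H K \<longleftrightarrow> finite (rcosets\<^bsub>K\<^esub> H)"

definition branch_group :: "'a set \<Rightarrow> ('a list \<Rightarrow> 'a list) set \<Rightarrow> bool"
  where "branch_group X G \<longleftrightarrow> subgroup G (tree_Aut X) \<and> spherically_transitive X G \<and>
    (\<forall>n. finite_index (Rist X G n) (sub_Aut X G))"

definition maximal_subgroup :: "'b set \<Rightarrow> ('b, 'c) monoid_scheme \<Rightarrow> bool"
  where "maximal_subgroup M K \<longleftrightarrow> subgroup M K \<and> M \<noteq> carrier K \<and>
    (\<forall>H. subgroup H K \<and> M \<subseteq> H \<longrightarrow> H = M \<or> H = carrier K)"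

end

theory Submission
  imports Defs "HOL-Combinatorics.Permutations"
begin

text \<open>
  Fix a letter \<open>z\<close> of a finite alphabet \<open>X\<close>.  A permutation \<open>c\<close> of \<open>X - {z}\<close> acts on words by
  moving the first letter different from \<open>z\<close> (\<open>spinal z c\<close>).  Away from the ray \<open>zzz...\<close> this
  automorphism changes no letter beyond some depth, while at the ray its germ remembers \<open>c\<close>.  Given a
  group \<open>C\<close> of such permutations, \<open>germ_group X z C\<close> consists of the automorphisms that, from some
  level on, act below each vertex as \<open>spinal z c\<close> with \<open>c \<in> C\<close> depending on the vertex.  It
  contains all finitary automorphisms (the case \<open>C = {id}\<close>), and \<open>C\<close> is the group of its germs at
  each ray ending in \<open>zzz...\<close>.  Thus inclusions between groups \<open>C\<close> become inclusions between
  groups of tree automorphisms, and the following properties are transferred.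

  Branch (\<open>branch_germ_group\<close>): membership is a condition on each subtree separately, so an element
  of a level stabiliser is the product of its restrictions to the subtrees of that level, each of
  which lies in the group.  Hence the rigid level stabiliser contains the level stabiliser, which has
  finite index.

  Infinite index (\<open>germ_group_infinite_index\<close>): if \<open>b \<in> B - C\<close>, the elements with germ \<open>b\<close> at one
  of infinitely many rays and trivial germs elsewhere lie in different cosets.

  Maximality (\<open>germ_group_maximal\<close>): suppose that \<open>C\<close> is maximal and self-normalising in \<open>B\<close>, and
  that a subgroup \<open>H\<close> strictly contains the group of \<open>C\<close>.  Correcting an element of \<open>H\<close> outside that
  group by a finitary automorphism makes it trivial on a level \<open>M\<close>, where it becomes an element
  \<open>\<beta>\<close> of the direct power \<open>B^(X^M)\<close> with some coordinate \<open>\<beta> v \<notin> C\<close>.  Conjugating by it an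
  element \<open>c \<in> C\<close> placed at \<open>v\<close> gives \<open>\<beta> v c (\<beta> v)\<^sup>-\<^sup>1\<close> placed at \<open>v\<close>, with all other coordinates
  trivial, and \<open>c\<close> can be chosen so that this is not in \<open>C\<close>.  By maximality of \<open>C\<close> the whole of
  \<open>B\<close>, placed at \<open>v\<close>, is in \<open>H\<close>; finitary automorphisms move it to all vertices of level \<open>M\<close>.

  The chain comes from the symmetric groups on \<open>{1..i + 2}\<close>, acting on the letters \<open>{0..n + 2}\<close> with
  \<open>z = 0\<close>: a point stabiliser in a symmetric group is maximal, and it is self-normalising as soon as
  it acts on at least two points.
\<close>

section \<open>Automorphisms of the tree of words\<close>

text \<open>An edge at \<open>u\<close> is sent to an edge at \<open>f u\<close>; by induction from the fixed root the edge to the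
  parent of \<open>f u\<close> is already taken, so children go to children.\<close>

lemma tree_aut_step:
  assumes f: "f \<in> tree_aut X" and u: "u \<in> lists X" and x: "x \<in> X"
  shows "\<exists>y\<in>X. f (u @ [x]) = f u @ [y]"
  using u x
proof (induction u arbitrary: x rule: rev_induct)
  case Nil
  have "tree_adj X (f []) (f ([] @ [x])) \<longleftrightarrow> tree_adj X [] ([] @ [x])"
    using f Nil unfolding tree_aut_def by fastforce
  then show ?case using f Nil by (auto simp: tree_adj_def tree_aut_def)
next
  case (snoc y u)
  have inj: "inj_on f (lists X)"
    using f by (auto simp: tree_aut_def Bij_def bij_betw_def)
  let ?v = "u @ [y]"
  have v: "?v \<in> lists X" "?v @ [x] \<in> lists X" using snoc by auto
  obtain y' where y': "f ?v = f u @ [y']" using snoc.IH[of y] snoc.prems by auto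
  have "tree_adj X (f ?v) (f (?v @ [x]))"
    using f v snoc.prems unfolding tree_aut_def by (auto simp: tree_adj_def)
  then consider z where "z \<in> X" "f (?v @ [x]) = f ?v @ [z]"
    | z where "f ?v = f (?v @ [x]) @ [z]"
    by (auto simp: tree_adj_def)
  then show ?case
  proof cases
    case 2
    then have "f u = f (?v @ [x])" using y' by simp
    then have "u = ?v @ [x]" using inj_onD[OF inj, of u "?v @ [x]"] v snoc.prems by auto
    then show ?thesis by simp
  qed auto
qed

text \<open>The portrait description of an automorphism: bijectivity and preservation of adjacency follow
  from what happens at the children of each single vertex.\<close>

lemma tree_aut_iff:
  assumes "finite X"
  shows "f \<in> tree_aut X \<longleftrightarrow> f \<in> extensional (lists X) \<and> f [] = [] \<and>
    (\<forall>u\<in>lists X. \<exists>p. bij_betw p X X \<and> (\<forall>x\<in>X. f (u @ [x]) = f u @ [p x]))"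
    (is "?L \<longleftrightarrow> ?R")
proof
  assume f: ?L
  have inj: "inj_on f (lists X)" and ext: "f \<in> extensional (lists X)" and "f [] = []"
    using f by (auto simp: tree_aut_def Bij_def bij_betw_def)
  moreover have "\<exists>p. bij_betw p X X \<and> (\<forall>x\<in>X. f (u @ [x]) = f u @ [p x])"
    if u: "u \<in> lists X" for u
  proof -
    obtain p where p: "\<And>x. x \<in> X \<Longrightarrow> p x \<in> X \<and> f (u @ [x]) = f u @ [p x]"
      using tree_aut_step[OF f u] by metis
    have "inj_on p X"
    proof (rule inj_onI)
      fix x y assume "x \<in> X" "y \<in> X" "p x = p y"
      then have "f (u @ [x]) = f (u @ [y])" using p by simp
      then show "x = y" using inj_onD[OF inj, of "u @ [x]" "u @ [y]"] u \<open>x \<in> X\<close> \<open>y \<in> X\<close> by auto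
    qed
    then have "bij_betw p X X"
      using p endo_inj_surj[OF assms, of p] by (auto simp: bij_betw_def)
    then show ?thesis using p by auto
  qed
  ultimately show ?R by blast
next
  assume R: ?R
  then have ext: "f \<in> extensional (lists X)" and nil: "f [] = []" by auto
  obtain p where p: "\<And>u. u \<in> lists X \<Longrightarrow> bij_betw (p u) X X"
    and fp: "\<And>u x. u \<in> lists X \<Longrightarrow> x \<in> X \<Longrightarrow> f (u @ [x]) = f u @ [p u x]"
    using R by metis
  have pX: "p u x \<in> X" if "u \<in> lists X" "x \<in> X" for u x
    using bij_betwE[OF p] that by blast
  have len: "length (f u) = length u \<and> f u \<in> lists X" if "u \<in> lists X" for u
    using that by (induction u rule: rev_induct) (auto simp: nil fp pX)
  have inj: "u = w" if "u \<in> lists X" "w \<in> lists X" "f u = f w" for u w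
    using that
  proof (induction u arbitrary: w rule: rev_induct)
    case Nil
    then show ?case using len[of w] nil by auto
  next
    case (snoc x u)
    then have "length w = Suc (length u)" using len[of w] len[of "u @ [x]"] by auto
    then obtain w' y where w: "w = w' @ [y]" by (cases w rule: rev_cases) auto
    then have "f u = f w'" "p u x = p w' y" using snoc.prems fp by auto
    then have "u = w'" using snoc.IH[of w'] snoc.prems w by auto
    moreover have "x = y"
      using p[of u] \<open>p u x = p w' y\<close> \<open>u = w'\<close> snoc.prems w
      by (auto simp: bij_betw_def dest: inj_onD)
    ultimately show ?case using w by simp
  qed
  have surj: "\<exists>u\<in>lists X. f u = w" if "w \<in> lists X" for w
    using that
  proof (induction w rule: rev_induct)
    case (snoc y w)
    then obtain u where u: "u \<in> lists X" "f u = w" by auto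
    moreover have "y \<in> p u ` X"
      using p[OF u(1)] snoc.prems by (auto simp: bij_betw_def)
    then obtain x where "x \<in> X" "p u x = y" by auto
    ultimately show ?case using u fp[of u x] by (intro bexI[of _ "u @ [x]"]) auto
  qed (use nil in auto)
  have bij: "bij_betw f (lists X) (lists X)"
    unfolding bij_betw_def inj_on_def using len inj surj by blast
  have half: "(\<exists>x\<in>X. f w = f u @ [x]) \<longleftrightarrow> (\<exists>x\<in>X. w = u @ [x])"
    if "u \<in> lists X" "w \<in> lists X" for u w
  proof
    assume "\<exists>x\<in>X. f w = f u @ [x]"
    then obtain x where x: "f w = f u @ [x]" by auto
    then have "length w = Suc (length u)" using len that by (metis length_append_singleton)
    then obtain w' y where w: "w = w' @ [y]" by (cases w rule: rev_cases) auto
    then have "f w' = f u" using fp[of w' y] that x by auto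
    then show "\<exists>x\<in>X. w = u @ [x]" using inj that w by auto
  next
    assume "\<exists>x\<in>X. w = u @ [x]"
    then show "\<exists>x\<in>X. f w = f u @ [x]" using fp[OF that(1)] pX[OF that(1)] by blast
  qed
  have "tree_adj X (f u) (f w) \<longleftrightarrow> tree_adj X u w" if "u \<in> lists X" "w \<in> lists X" for u w
    unfolding tree_adj_def using half that by blast
  then show ?L
    using ext bij nil by (simp add: tree_aut_def Bij_def)
qed

lemma tree_autI:
  assumes "finite X" "f [] = []" "\<And>u. u \<notin> lists X \<Longrightarrow> f u = undefined"
    and "\<And>u. u \<in> lists X \<Longrightarrow> \<exists>p. bij_betw p X X \<and> (\<forall>x\<in>X. f (u @ [x]) = f u @ [p x])"
  shows "f \<in> tree_aut X"
  using assms by (subst tree_aut_iff) (auto simp: extensional_def)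

lemma tree_aut_length:
  assumes "f \<in> tree_aut X" "u \<in> lists X"
  shows "length (f u) = length u"
  using assms(2)
proof (induction u rule: rev_induct)
  case (snoc x u)
  then show ?case using tree_aut_step[OF assms(1), of u x] by auto
qed (use assms in \<open>auto simp: tree_aut_def\<close>)

lemma tree_aut_mem: "f \<in> tree_aut X \<Longrightarrow> u \<in> lists X \<Longrightarrow> f u \<in> lists X"
  using Bij_imp_funcset by (fastforce simp: tree_aut_def)

lemma tree_aut_level: "f \<in> tree_aut X \<Longrightarrow> u \<in> level X n \<Longrightarrow> f u \<in> level X n"
  by (auto simp: level_def tree_aut_length dest: tree_aut_mem)

lemma tree_aut_prefix:
  assumes "f \<in> tree_aut X" "u \<in> lists X" "v \<in> lists X"
  shows "prefix (f u) (f (u @ v))"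
  using assms(3)
proof (induction v rule: rev_induct)
  case (snoc x v)
  then show ?case using tree_aut_step[OF assms(1), of "u @ v" x] assms by auto
qed simp

lemma tree_aut_undefined: "f \<in> tree_aut X \<Longrightarrow> u \<notin> lists X \<Longrightarrow> f u = undefined"
  by (auto simp: tree_aut_def Bij_def extensional_def)

lemma tree_aut_ext:
  assumes "f \<in> tree_aut X" "g \<in> tree_aut X" "\<And>u. u \<in> lists X \<Longrightarrow> f u = g u"
  shows "f = g"
proof
  fix u
  show "f u = g u"
    using assms tree_aut_undefined[of f X u] tree_aut_undefined[of g X u]
    by (cases "u \<in> lists X") simp_all
qed

lemma finite_level: "finite X \<Longrightarrow> finite (level X n)"
  using finite_lists_length_eq[of X n] by (simp add: level_def in_lists_conv_set subset_eq)

lemma tree_Aut_simps [simp]: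
  "carrier (tree_Aut X) = tree_aut X"
  "\<one>\<^bsub>tree_Aut X\<^esub> = (\<lambda>u\<in>lists X. u)"
  by (auto simp: tree_Aut_def BijGroup_def)

lemma mult_tree_Aut:
  assumes "f \<in> tree_aut X" "g \<in> tree_aut X" "u \<in> lists X"
  shows "(f \<otimes>\<^bsub>tree_Aut X\<^esub> g) u = f (g u)"
  using assms by (auto simp: tree_Aut_def BijGroup_def tree_aut_def compose_def)

lemma inv_tree_Aut:
  assumes "f \<in> tree_aut X" "u \<in> lists X"
  shows "f ((inv\<^bsub>tree_Aut X\<^esub> f) u) = u" "(inv\<^bsub>tree_Aut X\<^esub> f) (f u) = u"
proof -
  interpret group "tree_Aut X" by (rule group_tree_Aut)
  have i: "inv\<^bsub>tree_Aut X\<^esub> f \<in> tree_aut X" using assms inv_closed[of f] by simp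
  show "f ((inv\<^bsub>tree_Aut X\<^esub> f) u) = u"
    using mult_tree_Aut[OF assms(1) i assms(2)] r_inv[of f] assms by simp
  show "(inv\<^bsub>tree_Aut X\<^esub> f) (f u) = u"
    using mult_tree_Aut[OF i assms] l_inv[of f] assms by simp
qed

lemma one_tree_aut: "(\<lambda>u\<in>lists X. u) \<in> tree_aut X"
  using group.is_monoid[OF group_tree_Aut, THEN monoid.one_closed, of X] by simp

lemma one_mult_tree_Aut:
  assumes "f \<in> tree_aut X"
  shows "(\<lambda>u\<in>lists X. u) \<otimes>\<^bsub>tree_Aut X\<^esub> f = f" "f \<otimes>\<^bsub>tree_Aut X\<^esub> (\<lambda>u\<in>lists X. u) = f"
  using assms monoid.l_one[OF group.is_monoid[OF group_tree_Aut]]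
    monoid.r_one[OF group.is_monoid[OF group_tree_Aut]]
  by (metis tree_Aut_simps)+

lemma subgroup_sub_Aut:
  assumes "subgroup G (tree_Aut X)" "subgroup H (tree_Aut X)" "H \<subseteq> G"
  shows "subgroup H (sub_Aut X G)"
  using group.subgroup_incl[OF group_tree_Aut] assms by blast

text \<open>The witness transposes, in each position, the letters of \<open>u\<close> and \<open>w\<close>.\<close>

lemma tree_aut_transitive:
  assumes "finite X" "u \<in> level X n" "w \<in> level X n"
  shows "\<exists>g\<in>tree_aut X. g u = w"
proof -
  define q where "q i = (if i < n then transpose (u ! i) (w ! i) else id)" for i
  define g where "g = (\<lambda>v\<in>lists X. map (\<lambda>i. q i (v ! i)) [0..<length v])"
  have uw: "length u = n" "length w = n" "u \<in> lists X" "w \<in> lists X"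
    using assms by (auto simp: level_def)
  then have "u ! i \<in> X" "w ! i \<in> X" if "i < n" for i using that by auto
  then have q: "bij_betw (q i) X X" for i
    unfolding q_def using permutes_swap_id[of "u ! i" X "w ! i"]
    by (auto simp: permutes_imp_bij)
  then have qX: "q i x \<in> X" if "x \<in> X" for i x using that bij_betwE by blast
  have "g \<in> tree_aut X"
  proof (rule tree_autI[OF assms(1)])
    fix v assume "v \<in> lists X"
    then show "\<exists>p. bij_betw p X X \<and> (\<forall>x\<in>X. g (v @ [x]) = g v @ [p x])"
      by (intro exI[of _ "q (length v)"]) (auto simp: g_def q nth_append)
  qed (auto simp: g_def)
  moreover have "g u = w"
    using uw by (auto simp: g_def q_def intro!: nth_equalityI)
  ultimately show ?thesis by blast
qed

section \<open>Groups with prescribed germs\<close>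

fun spinal :: "'a \<Rightarrow> ('a \<Rightarrow> 'a) \<Rightarrow> 'a list \<Rightarrow> 'a list"
  where "spinal z c [] = []"
  | "spinal z c (x # u) = (if x = z then z # spinal z c u else c x # u)"

lemma spinal_id [simp]: "spinal z id u = u"
  by (induction u) auto

lemma spinal_comp:
  assumes "c z = z" "inj c"
  shows "spinal z b (spinal z c u) = spinal z (b \<circ> c) u"
  using assms by (induction u) (auto dest: injD[of c _ z])

lemma spinal_replicate [simp]: "spinal z c (replicate m z @ u) = replicate m z @ spinal z c u"
  by (induction m) auto

lemma spinal_snoc:
  "spinal z c (u @ [x]) = spinal z c u @ [if set u \<subseteq> {z} then spinal z c [x] ! 0 else x]"
  by (induction u) auto

text \<open>Permutations are functions on the whole type here, so that the same function can be an element
  of the symmetric groups of several nested sets.\<close>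

definition perm_group :: "'a set \<Rightarrow> ('a \<Rightarrow> 'a) set \<Rightarrow> bool"
  where "perm_group S C \<longleftrightarrow> (\<forall>c\<in>C. c permutes S) \<and> id \<in> C \<and>
    (\<forall>b\<in>C. \<forall>c\<in>C. b \<circ> c \<in> C) \<and> (\<forall>c\<in>C. Hilbert_Choice.inv c \<in> C)"

definition spinal_from :: "'a set \<Rightarrow> 'a \<Rightarrow> ('a \<Rightarrow> 'a) set \<Rightarrow> nat \<Rightarrow> ('a list \<Rightarrow> 'a list) \<Rightarrow> bool"
  where "spinal_from X z C N g \<longleftrightarrow>
    (\<forall>w\<in>level X N. \<exists>c\<in>C. \<forall>u\<in>lists X. g (w @ u) = g w @ spinal z c u)"

definition germ_group :: "'a set \<Rightarrow> 'a \<Rightarrow> ('a \<Rightarrow> 'a) set \<Rightarrow> ('a list \<Rightarrow> 'a list) set"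
  where "germ_group X z C = {g \<in> tree_aut X. \<exists>N. spinal_from X z C N g}"

text \<open>The automorphism that acts as \<open>g\<close> down to level \<open>N\<close> and as \<open>spinal z (\<beta> w)\<close> below each vertex
  \<open>w\<close> of that level.  On words shorter than \<open>N\<close> the second factor is empty, so \<open>\<beta>\<close> matters on level
  \<open>N\<close> only.\<close>

definition extend :: "'a set \<Rightarrow> 'a \<Rightarrow> nat \<Rightarrow> ('a list \<Rightarrow> 'a list) \<Rightarrow> ('a list \<Rightarrow> 'a \<Rightarrow> 'a)
    \<Rightarrow> 'a list \<Rightarrow> 'a list"
  where "extend X z N g \<beta> =
    (\<lambda>u\<in>lists X. g (take N u) @ spinal z (\<beta> (take N u)) (drop N u))"

definition restrict_to :: "'a set \<Rightarrow> 'a list set \<Rightarrow> ('a list \<Rightarrow> 'a list) \<Rightarrow> 'a list \<Rightarrow> 'a list"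
  where "restrict_to X S g = (\<lambda>u\<in>lists X. if \<exists>v\<in>S. prefix v u then g u else u)"

locale marked_alphabet =
  fixes X :: "'a set" and z :: 'a
  assumes finite_X: "finite X" and z_in: "z \<in> X"
begin

abbreviation "\<G> \<equiv> germ_group X z"
abbreviation "E \<equiv> extend X z"
abbreviation "SF \<equiv> spinal_from X z"

lemma permE:
  assumes "perm_group (X - {z}) C" "c \<in> C"
  shows "c z = z" "inj c" "bij_betw c X X" "c permutes X"
proof -
  have c: "c permutes X - {z}" using assms by (auto simp: perm_group_def)
  then show "c z = z" "inj c" by (auto simp: permutes_not_in permutes_inj)
  show "c permutes X" using permutes_subset[OF c] by auto
  then show "bij_betw c X X" by (rule permutes_imp_bij)
qed

lemma spinal_lists:
  assumes "perm_group (X - {z}) C" "c \<in> C" "u \<in> lists X"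
  shows "spinal z c u \<in> lists X"
  using assms(3) permutes_in_image[OF permE(4)[OF assms(1,2)]]
  by (induction u) auto

text \<open>The restriction of \<open>spinal z c\<close> to the subtree of a letter \<open>x\<close> is \<open>spinal z c\<close> again if
  \<open>x = z\<close>, and the identity otherwise.\<close>

lemma spinal_from_mono:
  assumes "id \<in> C" "SF C N g" "N \<le> M"
  shows "SF C M g"
  using assms(3,2)
proof (induction rule: dec_induct)
  case (step M)
  show ?case unfolding spinal_from_def
  proof
    fix w assume "w \<in> level X (Suc M)"
    then obtain v x where w: "w = v @ [x]" and v: "v \<in> level X M" and x: "x \<in> X"
      by (cases w rule: rev_cases) (auto simp: level_def)
    obtain c where c: "c \<in> C" and g: "\<And>u. u \<in> lists X \<Longrightarrow> g (v @ u) = g v @ spinal z c u"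
      using step v unfolding spinal_from_def by blast
    show "\<exists>c\<in>C. \<forall>u\<in>lists X. g (w @ u) = g w @ spinal z c u"
    proof (cases "x = z")
      case True
      then show ?thesis using c w x g[of "x # _"] g[of "[x]"] by (intro bexI[of _ c]) auto
    next
      case False
      then show ?thesis using assms(1) w x g[of "x # _"] g[of "[x]"] by (intro bexI[of _ id]) auto
    qed
  qed
qed

lemma germ_group_mono: "C \<subseteq> B \<Longrightarrow> \<G> C \<subseteq> \<G> B"
  unfolding germ_group_def spinal_from_def by blast

lemma germ_group_aut: "g \<in> \<G> C \<Longrightarrow> g \<in> tree_aut X"
  by (simp add: germ_group_def)

lemma subgroup_germ_group:
  assumes C: "perm_group (X - {z}) C"
  shows "subgroup (\<G> C) (tree_Aut X)"
proof (rule group.subgroupI[OF group_tree_Aut])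
  have id: "id \<in> C" using C by (simp add: perm_group_def)
  show "\<G> C \<subseteq> carrier (tree_Aut X)" by (auto simp: germ_group_def)
  have "(\<lambda>u\<in>lists X. u) \<in> \<G> C"
    using one_tree_aut id by (auto simp: germ_group_def spinal_from_def level_def intro!: bexI[of _ id])
  then show "\<G> C \<noteq> {}" by blast
next
  have inv: "\<And>c. c \<in> C \<Longrightarrow> Hilbert_Choice.inv c \<in> C" using C by (auto simp: perm_group_def)
  fix g assume "g \<in> \<G> C"
  then obtain N where g: "g \<in> tree_aut X" and N: "SF C N g" by (auto simp: germ_group_def)
  let ?h = "inv\<^bsub>tree_Aut X\<^esub> g"
  have h: "?h \<in> tree_aut X" using group.inv_closed[OF group_tree_Aut, of g X] g by simp
  have "SF C N ?h" unfolding spinal_from_def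
  proof
    fix w assume w: "w \<in> level X N"
    then have hw: "?h w \<in> level X N" "?h w \<in> lists X" "w \<in> lists X"
      using tree_aut_level[OF h] by (auto simp: level_def)
    obtain c where c: "c \<in> C" and gc: "\<And>u. u \<in> lists X \<Longrightarrow> g (?h w @ u) = w @ spinal z c u"
      using N hw inv_tree_Aut(1)[OF g, of w] unfolding spinal_from_def by metis
    have "?h (w @ u) = ?h w @ spinal z (Hilbert_Choice.inv c) u" if u: "u \<in> lists X" for u
    proof -
      have l: "spinal z (Hilbert_Choice.inv c) u \<in> lists X" using spinal_lists[OF C inv[OF c] u] .
      have "c \<circ> Hilbert_Choice.inv c = id"
        using permutes_inv_o(1)[OF permE(4)[OF C c]] .
      then have "g (?h w @ spinal z (Hilbert_Choice.inv c) u) = w @ u"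
        using gc[OF l] permE[OF C inv[OF c]] by (simp add: spinal_comp)
      then show ?thesis using inv_tree_Aut(2)[OF g, of "?h w @ spinal z (Hilbert_Choice.inv c) u"] l hw by simp
    qed
    then show "\<exists>c\<in>C. \<forall>u\<in>lists X. ?h (w @ u) = ?h w @ spinal z c u" using inv[OF c] by blast
  qed
  then show "?h \<in> \<G> C" using h by (auto simp: germ_group_def)
next
  have id: "id \<in> C" and comp: "\<And>b c. b \<in> C \<Longrightarrow> c \<in> C \<Longrightarrow> b \<circ> c \<in> C"
    using C by (auto simp: perm_group_def)
  fix g h assume gh: "g \<in> \<G> C" "h \<in> \<G> C"
  then obtain N M where g: "g \<in> tree_aut X" "h \<in> tree_aut X" and "SF C N g" "SF C M h"
    by (auto simp: germ_group_def)
  then have N: "SF C (max N M) g" "SF C (max N M) h" using spinal_from_mono[OF id] by auto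
  have "SF C (max N M) (g \<otimes>\<^bsub>tree_Aut X\<^esub> h)" unfolding spinal_from_def
  proof
    fix w assume w: "w \<in> level X (max N M)"
    have hw: "h w \<in> level X (max N M)" and wX: "w \<in> lists X"
      using w tree_aut_level[OF g(2)] by (auto simp: level_def)
    obtain b where b: "b \<in> C" "\<And>u. u \<in> lists X \<Longrightarrow> h (w @ u) = h w @ spinal z b u"
      using N w unfolding spinal_from_def by blast
    obtain c where c: "c \<in> C" "\<And>u. u \<in> lists X \<Longrightarrow> g (h w @ u) = g (h w) @ spinal z c u"
      using N hw unfolding spinal_from_def by blast
    have "(g \<otimes>\<^bsub>tree_Aut X\<^esub> h) (w @ u) = (g \<otimes>\<^bsub>tree_Aut X\<^esub> h) w @ spinal z (c \<circ> b) u"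
      if "u \<in> lists X" for u
      using that wX b c permE[OF C b(1)] spinal_lists[OF C b(1)]
      by (simp add: mult_tree_Aut[OF g] spinal_comp)
    then show "\<exists>d\<in>C. \<forall>u\<in>lists X. (g \<otimes>\<^bsub>tree_Aut X\<^esub> h) (w @ u) =
        (g \<otimes>\<^bsub>tree_Aut X\<^esub> h) w @ spinal z d u"
      using comp[OF c(1) b(1)] by blast
  qed
  then show "g \<otimes>\<^bsub>tree_Aut X\<^esub> h \<in> \<G> C"
    using subgroup.m_closed[OF group.subgroup_self[OF group_tree_Aut], of g X h] g
    by (auto simp: germ_group_def)
qed

lemma extend_append:
  assumes "w \<in> level X N" "u \<in> lists X"
  shows "E N g \<beta> (w @ u) = g w @ spinal z (\<beta> w) u"
  using assms by (simp add: extend_def level_def)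

lemma extend_short:
  assumes "u \<in> lists X" "length u \<le> N"
  shows "E N g \<beta> u = g u"
  using assms by (simp add: extend_def)

lemma extend_trivial:
  assumes "u \<in> lists X" "\<beta> (take N u) = id"
  shows "E N (\<lambda>u\<in>lists X. u) \<beta> u = u"
proof -
  have "take N u \<in> lists X" using assms(1) by (auto dest: in_set_takeD)
  then show ?thesis using assms unfolding extend_def by (simp del: in_lists_conv_set)
qed

lemma extend_in:
  assumes C: "perm_group (X - {z}) C" and g: "g \<in> tree_aut X"
    and \<beta>: "\<And>w. w \<in> level X N \<Longrightarrow> \<beta> w \<in> C"
  shows "E N g \<beta> \<in> \<G> C"
proof -
  have "E N g \<beta> \<in> tree_aut X"
  proof (rule tree_autI[OF finite_X])
    show "E N g \<beta> [] = []" using g by (simp add: extend_def tree_aut_def)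
    fix u assume u: "u \<in> lists X"
    show "\<exists>p. bij_betw p X X \<and> (\<forall>x\<in>X. E N g \<beta> (u @ [x]) = E N g \<beta> u @ [p x])"
    proof (cases "length u < N")
      case True
      then show ?thesis using g u by (auto simp: extend_short tree_aut_iff[OF finite_X])
    next
      case False
      then have tu: "take N u \<in> level X N" using u by (auto simp: level_def dest: in_set_takeD)
      note c = permE[OF C \<beta>[OF tu]]
      show ?thesis
      proof (cases "set (drop N u) \<subseteq> {z}")
        case True
        then show ?thesis using False u c
          by (intro exI[of _ "\<beta> (take N u)"]) (auto simp: extend_def spinal_snoc)
      next
        case f: False
        then show ?thesis using False u
          by (intro exI[of _ id]) (auto simp: extend_def spinal_snoc)
      qed
    qed
  qed (auto simp: extend_def)
  moreover have "SF C N (E N g \<beta>)"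
    unfolding spinal_from_def using \<beta> extend_append[of _ N] extend_append[of _ N "[]"]
    by (metis append_Nil2 lists.Nil spinal.simps(1))
  ultimately show ?thesis by (auto simp: germ_group_def)
qed

text \<open>Together with \<open>extend_in\<close> this shows that \<open>extend\<close> produces exactly the elements of the germ
  group.\<close>

lemma spinal_from_extend:
  assumes g: "g \<in> tree_aut X" and "SF C N g"
  shows "\<exists>\<beta>. (\<forall>w\<in>level X N. \<beta> w \<in> C) \<and> g = E N g \<beta>"
proof -
  obtain \<beta> where \<beta>: "\<And>w. w \<in> level X N \<Longrightarrow> \<beta> w \<in> C"
    and e: "\<And>w u. w \<in> level X N \<Longrightarrow> u \<in> lists X \<Longrightarrow> g (w @ u) = g w @ spinal z (\<beta> w) u"
    using assms(2) unfolding spinal_from_def by metis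
  have "g u = E N g \<beta> u" for u
  proof (cases "u \<in> lists X")
    case True
    show ?thesis
    proof (cases "length u \<le> N")
      case False
      then have "take N u \<in> level X N" "drop N u \<in> lists X"
        using True by (auto simp: level_def dest: in_set_takeD in_set_dropD)
      then show ?thesis
        using e[of "take N u" "drop N u"] extend_append[of "take N u" N "drop N u"] by simp
    qed (use True extend_short in simp)
  qed (use tree_aut_undefined[OF g] in \<open>simp add: extend_def\<close>)
  then show ?thesis using \<beta> by blast
qed

lemma extend_cong:
  assumes "\<And>w. w \<in> level X N \<Longrightarrow> \<beta> w = \<gamma> w"
  shows "E N g \<beta> = E N g \<gamma>"
proof -
  have "E N g \<beta> u = E N g \<gamma> u" for u
  proof (cases "u \<in> lists X")
    case True
    show ?thesis
    proof (cases "length u \<le> N")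
      case False
      then have "take N u \<in> level X N" using True by (auto simp: level_def dest: in_set_takeD)
      then show ?thesis using assms by (simp add: extend_def)
    qed (use True extend_short in simp)
  qed (simp add: extend_def)
  then show ?thesis by blast
qed

text \<open>The wreath product multiplication rule, to which all later computations are reduced.\<close>

lemma extend_mult:
  assumes B: "perm_group (X - {z}) B" and g: "g \<in> tree_aut X" "h \<in> tree_aut X"
    and \<beta>: "\<And>w. w \<in> level X N \<Longrightarrow> \<beta> w \<in> B" and \<gamma>: "\<And>w. w \<in> level X N \<Longrightarrow> \<gamma> w \<in> B"
  shows "E N g \<beta> \<otimes>\<^bsub>tree_Aut X\<^esub> E N h \<gamma>
    = E N (g \<otimes>\<^bsub>tree_Aut X\<^esub> h) (\<lambda>w. \<beta> (h w) \<circ> \<gamma> w)"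
proof (rule tree_aut_ext)
  interpret group "tree_Aut X" by (rule group_tree_Aut)
  have \<beta>h: "\<beta> (h w) \<circ> \<gamma> w \<in> B" if "w \<in> level X N" for w
    using that \<beta> \<gamma> tree_aut_level[OF g(2)] B by (auto simp: perm_group_def)
  have gh: "g \<otimes>\<^bsub>tree_Aut X\<^esub> h \<in> tree_aut X" using g m_closed[of g h] by simp
  have Eg: "E N g \<beta> \<in> tree_aut X" and Eh: "E N h \<gamma> \<in> tree_aut X"
    using germ_group_aut[OF extend_in[OF B]] g \<beta> \<gamma> by blast+
  show "E N g \<beta> \<otimes>\<^bsub>tree_Aut X\<^esub> E N h \<gamma> \<in> tree_aut X" using Eg Eh m_closed[of "E N g \<beta>" "E N h \<gamma>"] by simp
  show "E N (g \<otimes>\<^bsub>tree_Aut X\<^esub> h) (\<lambda>w. \<beta> (h w) \<circ> \<gamma> w) \<in> tree_aut X"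
    by (rule germ_group_aut[OF extend_in[OF B gh]]) (rule \<beta>h)
  fix u assume u: "u \<in> lists X"
  show "(E N g \<beta> \<otimes>\<^bsub>tree_Aut X\<^esub> E N h \<gamma>) u =
      E N (g \<otimes>\<^bsub>tree_Aut X\<^esub> h) (\<lambda>w. \<beta> (h w) \<circ> \<gamma> w) u"
  proof (cases "length u \<le> N")
    case True
    then show ?thesis using u tree_aut_length[OF g(2) u] tree_aut_mem[OF g(2) u]
      by (simp add: mult_tree_Aut[OF Eg Eh] extend_short mult_tree_Aut[OF g])
  next
    case False
    define w v where "w = take N u" and "v = drop N u"
    then have w: "w \<in> level X N" "w \<in> lists X" and v: "v \<in> lists X" and uwv: "u = w @ v"
      using False u by (auto simp: level_def dest: in_set_takeD in_set_dropD)
    note hw = tree_aut_level[OF g(2) w(1)]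
    have l: "spinal z (\<gamma> w) v \<in> lists X" using spinal_lists[OF B \<gamma>[OF w(1)] v] .
    have "(E N g \<beta> \<otimes>\<^bsub>tree_Aut X\<^esub> E N h \<gamma>) u = E N g \<beta> (h w @ spinal z (\<gamma> w) v)"
      using mult_tree_Aut[OF Eg Eh u] extend_append[OF w(1) v] uwv by simp
    also have "\<dots> = g (h w) @ spinal z (\<beta> (h w)) (spinal z (\<gamma> w) v)"
      using extend_append[OF hw l] .
    also have "\<dots> = g (h w) @ spinal z (\<beta> (h w) \<circ> \<gamma> w) v"
      using permE[OF B \<gamma>[OF w(1)]] by (simp add: spinal_comp)
    finally show ?thesis using extend_append[OF w(1) v] mult_tree_Aut[OF g w(2)] uwv by simp
  qed
qed


section \<open>The branch property\<close>

text \<open>Membership in the germ group is checked below each vertex of a deep level separately, and such a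
  subtree is either inside or outside the subtrees of \<open>S\<close>.\<close>

lemma restrict_to_in:
  assumes C: "perm_group (X - {z}) C" and g: "g \<in> \<G> C"
    and S: "S \<subseteq> level X n" and fix_S: "\<And>v. v \<in> S \<Longrightarrow> g v = v"
  shows "restrict_to X S g \<in> \<G> C"
proof -
  have ga: "g \<in> tree_aut X" using g germ_group_aut by blast
  have id: "id \<in> C" using C by (simp add: perm_group_def)
  obtain N where "SF C N g" using g by (auto simp: germ_group_def)
  then have N: "SF C (max n N) g" using spinal_from_mono[OF id] by auto
  have "restrict_to X S g \<in> tree_aut X"
  proof (rule tree_autI[OF finite_X])
    show "restrict_to X S g [] = []"
      using ga by (simp add: restrict_to_def tree_aut_def)
    fix u assume u: "u \<in> lists X"
    show "\<exists>p. bij_betw p X X \<and> (\<forall>x\<in>X. restrict_to X S g (u @ [x]) = restrict_to X S g u @ [p x])"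
    proof (cases "\<exists>v\<in>S. prefix v u")
      case True
      then have "\<exists>v\<in>S. prefix v (u @ [x])" for x by (meson prefix_prefix)
      moreover obtain p where "bij_betw p X X" "\<forall>x\<in>X. g (u @ [x]) = g u @ [p x]"
        using ga u unfolding tree_aut_iff[OF finite_X] by blast
      ultimately show ?thesis using True u by (intro exI[of _ p]) (auto simp: restrict_to_def)
    next
      case False
      then have "v = u @ [x]" if "v \<in> S" "prefix v (u @ [x])" for v x using that by auto
      then show ?thesis using False u fix_S
        by (intro exI[of _ id]) (auto simp: restrict_to_def)
    qed
  qed (auto simp: restrict_to_def)
  moreover have "SF C (max n N) (restrict_to X S g)"
    unfolding spinal_from_def
  proof
    fix w assume w: "w \<in> level X (max n N)"
    then have wX: "w \<in> lists X" "length w = max n N" by (auto simp: level_def)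
    have iff: "(\<exists>v\<in>S. prefix v (w @ u)) \<longleftrightarrow> (\<exists>v\<in>S. prefix v w)" for u
    proof -
      have "prefix v (w @ u) \<longleftrightarrow> prefix v w" if "v \<in> S" for v
        using that S wX prefix_length_prefix[of v "w @ u" w] by (auto simp: level_def)
      then show ?thesis by blast
    qed
    show "\<exists>c\<in>C. \<forall>u\<in>lists X. restrict_to X S g (w @ u) = restrict_to X S g w @ spinal z c u"
    proof (cases "\<exists>v\<in>S. prefix v w")
      case True
      then show ?thesis using N w wX iff unfolding spinal_from_def restrict_to_def by simp
    next
      case False
      then show ?thesis using iff wX id unfolding restrict_to_def
        by (intro bexI[of _ id]) simp_all
    qed
  qed
  ultimately show ?thesis by (auto simp: germ_group_def)
qed

text \<open>The element is assembled from its restrictions to the subtrees of level \<open>n\<close>, one vertex at a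
  time.\<close>

lemma level_stabiliser_in_Rist:
  assumes C: "perm_group (X - {z}) C" and k: "k \<in> \<G> C"
    and fix_n: "\<And>v. v \<in> level X n \<Longrightarrow> k v = v"
  shows "k \<in> Rist X (\<G> C) n"
proof -
  have ka: "k \<in> tree_aut X" using k germ_group_aut by blast
  have "restrict_to X S k \<in> Rist X (\<G> C) n" if "S \<subseteq> level X n" for S
    using finite_subset[OF that finite_level[OF finite_X]] that
  proof (induction S rule: finite_induct)
    case empty
    have "restrict_to X {} k = \<one>\<^bsub>sub_Aut X (\<G> C)\<^esub>"
      by (simp add: restrict_to_def restrict_def)
    then show ?case unfolding Rist_def using generate.one by metis
  next
    case (insert v S)
    have v: "v \<in> level X n" "v \<in> lists X" and S: "S \<subseteq> level X n"
      using insert.prems by (auto simp: level_def)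
    note aut = germ_group_aut[OF restrict_to_in[OF C k]]
    have aS: "restrict_to X S k \<in> tree_aut X" and av: "restrict_to X {v} k \<in> tree_aut X"
      and avS: "restrict_to X (insert v S) k \<in> tree_aut X"
      using aut[OF S] aut[of "{v}"] aut[of "insert v S"] fix_n v S by auto
    have "restrict_to X {v} k \<in> rist X (\<G> C) v"
      using restrict_to_in[OF C k, of "{v}" n] v fix_n by (auto simp: rist_def restrict_to_def)
    then have 1: "restrict_to X {v} k \<in> Rist X (\<G> C) n"
      unfolding Rist_def using v by (blast intro: generate.incl)
    have "restrict_to X (insert v S) k = restrict_to X S k \<otimes>\<^bsub>tree_Aut X\<^esub> restrict_to X {v} k"
    proof (rule tree_aut_ext[OF avS])
      show "restrict_to X S k \<otimes>\<^bsub>tree_Aut X\<^esub> restrict_to X {v} k \<in> tree_aut X"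
        using subgroup.m_closed[OF group.subgroup_self[OF group_tree_Aut], of _ X] aS av by simp
      fix u assume u: "u \<in> lists X"
      show "restrict_to X (insert v S) k u =
        (restrict_to X S k \<otimes>\<^bsub>tree_Aut X\<^esub> restrict_to X {v} k) u"
      proof (cases "prefix v u")
        case True
        then obtain r where r: "u = v @ r" by (auto simp: prefix_def)
        then have pv: "prefix v (k u)"
          using tree_aut_prefix[OF ka v(2), of r] fix_n[OF v(1)] u by simp
        have "\<not> prefix s (k u)" if "s \<in> S" for s
        proof
          assume "prefix s (k u)"
          then have "prefix s v \<or> prefix v s" using pv prefix_same_cases by blast
          moreover have "length s = length v" using that S v by (auto simp: level_def)
          ultimately have "s = v" by (auto simp: prefix_def)
          then show False using that insert.hyps by simp
        qed
        then show ?thesis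
          using True u tree_aut_mem[OF ka u] unfolding mult_tree_Aut[OF aS av u]
          by (auto simp: restrict_to_def)
      next
        case False
        then show ?thesis using u unfolding mult_tree_Aut[OF aS av u]
          by (simp add: restrict_to_def)
      qed
    qed
    moreover have "restrict_to X S k \<otimes>\<^bsub>sub_Aut X (\<G> C)\<^esub> restrict_to X {v} k \<in> Rist X (\<G> C) n"
      using insert.IH[OF S] 1 unfolding Rist_def by (rule generate.eng)
    ultimately show ?case by simp
  qed
  from this[of "level X n"] have "restrict_to X (level X n) k \<in> Rist X (\<G> C) n" by simp
  moreover have "restrict_to X (level X n) k = k"
  proof (rule tree_aut_ext[OF _ ka])
    show "restrict_to X (level X n) k \<in> tree_aut X"
      using germ_group_aut[OF restrict_to_in[OF C k]] fix_n by blast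
    fix u assume u: "u \<in> lists X"
    show "restrict_to X (level X n) k u = k u"
    proof (cases "length u < n")
      case True
      \<comment> \<open>Above level \<open>n\<close> the restriction is trivial by definition, and \<open>k\<close> is trivial because
        \<open>u\<close> has a descendant on level \<open>n\<close>.\<close>
      let ?r = "replicate (n - length u) z"
      have "?r \<in> lists X" "u @ ?r \<in> level X n" using u True z_in by (auto simp: level_def)
      then have "prefix (k u) (u @ ?r)" using tree_aut_prefix[OF ka u, of ?r] fix_n by simp
      then have "k u = u" using tree_aut_length[OF ka u]
        by (metis prefix_length_prefix prefix_order.dual_order.eq_iff prefixI order_refl)
      then show ?thesis using u by (simp add: restrict_to_def)
    next
      case False
      then have "take n u \<in> level X n" using u by (auto simp: level_def dest: in_set_takeD)
      then show ?thesis using u take_is_prefix by (auto simp: restrict_to_def)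
    qed
  qed
  ultimately show ?thesis by simp
qed

end

lemma finite_indexI:
  assumes "group K" "subgroup H K" "finite (\<phi> ` carrier K)"
    and sep: "\<And>g h. g \<in> carrier K \<Longrightarrow> h \<in> carrier K \<Longrightarrow> \<phi> g = \<phi> h \<Longrightarrow> g \<otimes>\<^bsub>K\<^esub> inv\<^bsub>K\<^esub> h \<in> H"
  shows "finite_index H K"
proof -
  interpret group K by (rule assms(1))
  define s where "s y = (SOME g. g \<in> carrier K \<and> \<phi> g = y)" for y
  have "H #>\<^bsub>K\<^esub> g = H #>\<^bsub>K\<^esub> s (\<phi> g)" if g: "g \<in> carrier K" for g
  proof -
    have s: "s (\<phi> g) \<in> carrier K" "\<phi> (s (\<phi> g)) = \<phi> g"
      using someI[of "\<lambda>h. h \<in> carrier K \<and> \<phi> h = \<phi> g" g] g by (auto simp: s_def)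
    have "g = (g \<otimes>\<^bsub>K\<^esub> inv\<^bsub>K\<^esub> s (\<phi> g)) \<otimes>\<^bsub>K\<^esub> s (\<phi> g)" using g s by (simp add: m_assoc)
    then have "g \<in> H #>\<^bsub>K\<^esub> s (\<phi> g)" using sep[OF g s(1)] s(2) unfolding r_coset_def by auto
    then show ?thesis using repr_independence[OF _ s(1) assms(2)] by simp
  qed
  then have "rcosets\<^bsub>K\<^esub> H \<subseteq> (\<lambda>y. H #>\<^bsub>K\<^esub> s y) ` \<phi> ` carrier K"
    unfolding RCOSETS_def by auto
  then show ?thesis unfolding finite_index_def using assms(3) finite_surj by blast
qed

lemma finite_index_carrier: "group K \<Longrightarrow> finite_index (carrier K) K"
  by (rule finite_indexI[where \<phi> = "\<lambda>_. ()"]) (auto simp: group.subgroup_self group.is_monoid monoid.m_closed group.inv_closed)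

lemma not_finite_indexI:
  fixes t :: "nat \<Rightarrow> 'b"
  assumes "group K" "subgroup H K" "\<And>k. t k \<in> carrier K"
    and sep: "\<And>k l. k \<noteq> l \<Longrightarrow> t k \<notin> H #>\<^bsub>K\<^esub> t l"
  shows "\<not> finite_index H K"
proof
  interpret group K by (rule assms(1))
  assume "finite_index H K"
  moreover have "range (\<lambda>k. H #>\<^bsub>K\<^esub> t k) \<subseteq> rcosets\<^bsub>K\<^esub> H"
    using assms(3) by (auto simp: RCOSETS_def)
  ultimately have "finite (range (\<lambda>k. H #>\<^bsub>K\<^esub> t k))"
    unfolding finite_index_def using finite_subset by blast
  moreover have "inj (\<lambda>k. H #>\<^bsub>K\<^esub> t k)"
    using sep rcos_self[OF assms(3) assms(2)] by (intro injI) metis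
  ultimately show False using finite_imageD by blast
qed

context marked_alphabet
begin

lemma group_sub_germ: "perm_group (X - {z}) C \<Longrightarrow> group (sub_Aut X (\<G> C))"
  by (rule subgroup.subgroup_is_group[OF subgroup_germ_group group_tree_Aut])

lemma inv_sub_germ:
  assumes "perm_group (X - {z}) C" "g \<in> \<G> C"
  shows "inv\<^bsub>sub_Aut X (\<G> C)\<^esub> g = inv\<^bsub>tree_Aut X\<^esub> g"
  using group.m_inv_consistent[OF group_tree_Aut subgroup_germ_group] assms by blast

theorem branch_germ_group:
  assumes C: "perm_group (X - {z}) C"
  shows "branch_group X (\<G> C)"
  unfolding branch_group_def
proof (intro conjI allI)
  show sub: "subgroup (\<G> C) (tree_Aut X)" by (rule subgroup_germ_group[OF C])
  show "spherically_transitive X (\<G> C)"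
    unfolding spherically_transitive_def
  proof (intro allI ballI)
    fix n u w assume u: "u \<in> level X n" and w: "w \<in> level X n"
    obtain g where g: "g \<in> tree_aut X" "g u = w"
      using tree_aut_transitive[OF finite_X u w] by blast
    have "E n g (\<lambda>_. id) \<in> \<G> C" using extend_in[OF C g(1)] C by (simp add: perm_group_def)
    moreover have "E n g (\<lambda>_. id) u = w" using u g by (simp add: extend_short level_def)
    ultimately show "\<exists>g\<in>\<G> C. g u = w" by blast
  qed
  fix n
  show "finite_index (Rist X (\<G> C) n) (sub_Aut X (\<G> C))"
  proof (rule finite_indexI[where \<phi> = "\<lambda>g. restrict g (level X n)"])
    show "group (sub_Aut X (\<G> C))" by (rule group_sub_germ[OF C])
    then show "subgroup (Rist X (\<G> C) n) (sub_Aut X (\<G> C))"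
      unfolding Rist_def by (rule group.generate_is_subgroup) (auto simp: rist_def)
    have "(\<lambda>g. restrict g (level X n)) ` carrier (sub_Aut X (\<G> C))
        \<subseteq> level X n \<rightarrow>\<^sub>E level X n"
      using tree_aut_level germ_group_aut by fastforce
    then show "finite ((\<lambda>g. restrict g (level X n)) ` carrier (sub_Aut X (\<G> C)))"
      using finite_subset finite_PiE finite_level[OF finite_X] by meson
    fix g h
    assume "g \<in> carrier (sub_Aut X (\<G> C))" "h \<in> carrier (sub_Aut X (\<G> C))"
      and eq: "restrict g (level X n) = restrict h (level X n)"
    then have gh: "g \<in> \<G> C" "h \<in> \<G> C" by auto
    let ?i = "inv\<^bsub>tree_Aut X\<^esub> h"
    have i: "?i \<in> \<G> C" using subgroup.m_inv_closed[OF sub gh(2)] .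
    have a: "g \<in> tree_aut X" "h \<in> tree_aut X" "?i \<in> tree_aut X"
      using gh i germ_group_aut by auto
    have "g \<otimes>\<^bsub>tree_Aut X\<^esub> ?i \<in> Rist X (\<G> C) n"
    proof (rule level_stabiliser_in_Rist[OF C])
      show "g \<otimes>\<^bsub>tree_Aut X\<^esub> ?i \<in> \<G> C" using subgroup.m_closed[OF sub gh(1) i] .
      fix v assume v: "v \<in> level X n"
      then have "g (?i v) = h (?i v)"
        using fun_cong[OF eq, of "?i v"] tree_aut_level[OF a(3) v] by simp
      then show "(g \<otimes>\<^bsub>tree_Aut X\<^esub> ?i) v = v"
        using v inv_tree_Aut(1)[OF a(2), of v] mult_tree_Aut[OF a(1,3)] by (simp add: level_def)
    qed
    then show "g \<otimes>\<^bsub>sub_Aut X (\<G> C)\<^esub> inv\<^bsub>sub_Aut X (\<G> C)\<^esub> h \<in> Rist X (\<G> C) n"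
      using inv_sub_germ[OF C gh(2)] by simp
  qed
qed

section \<open>Infinite index\<close>

text \<open>The germ of \<open>t k\<close> is \<open>b\<close> at the ray \<open>x^k zzz...\<close> and trivial at the rays \<open>x^l zzz...\<close> for
  \<open>l \<noteq> k\<close>; hence the germ of \<open>t k (t l)\<^sup>-\<^sup>1\<close> at \<open>x^k zzz...\<close> is \<open>b \<notin> C\<close>.\<close>

theorem germ_group_infinite_index:
  assumes B: "perm_group (X - {z}) B" and C: "perm_group (X - {z}) C" and CB: "C \<subset> B"
  shows "\<not> finite_index (\<G> C) (sub_Aut X (\<G> B))"
proof -
  obtain b where b: "b \<in> B" "b \<notin> C" using CB by blast
  have bp: "b permutes X - {z}" using B b by (auto simp: perm_group_def)
  have "b \<noteq> id" using b C by (auto simp: perm_group_def)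
  then obtain x where "b x \<noteq> x" by fastforce
  then have x: "x \<in> X" "x \<noteq> z" using bp by (auto simp: permutes_def)
  have idB: "id \<in> B" "id \<in> C" using B C by (auto simp: perm_group_def)
  define v where "v k = replicate k x @ [z]" for k
  define t where "t k = E (Suc k) (\<lambda>u\<in>lists X. u) ((\<lambda>_. id)(v k := b))" for k
  have vX: "v k \<in> level X (Suc k)" for k using x z_in by (auto simp: v_def level_def)
  have t: "t k \<in> \<G> B" for k
    unfolding t_def using extend_in[OF B one_tree_aut] b idB by auto
  show ?thesis
  proof (rule not_finite_indexI)
    show "group (sub_Aut X (\<G> B))" by (rule group_sub_germ[OF B])
    show "subgroup (\<G> C) (sub_Aut X (\<G> B))"
      using subgroup_sub_Aut subgroup_germ_group B C germ_group_mono CB by blast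
    show "t k \<in> carrier (sub_Aut X (\<G> B))" for k using t by simp
    fix k l :: nat assume "k \<noteq> l"
    show "t k \<notin> \<G> C #>\<^bsub>sub_Aut X (\<G> B)\<^esub> t l"
    proof
      assume "t k \<in> \<G> C #>\<^bsub>sub_Aut X (\<G> B)\<^esub> t l"
      then obtain a where a: "a \<in> \<G> C" and tk: "t k = a \<otimes>\<^bsub>tree_Aut X\<^esub> t l"
        by (auto simp: r_coset_def)
      obtain N where "SF C N a" using a by (auto simp: germ_group_def)
      then have SF: "SF C (Suc k + N) a" using spinal_from_mono[OF idB(2)] by simp
      \<comment> \<open>A vertex on the ray \<open>x^k zzz...\<close>, deep enough for \<open>a\<close> to act below it through \<open>C\<close>.\<close>
      define w where "w = v k @ replicate N z"
      have w: "w \<in> level X (Suc k + N)" using vX[of k] z_in by (auto simp: w_def level_def)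
      have "a (w @ u) = w @ spinal z b u" if u: "u \<in> lists X" for u
      proof -
        have wu: "w @ u \<in> lists X" using w u by (auto simp: level_def)
        have "take (Suc l) (w @ u) \<noteq> v l"
        proof
          assume eq: "take (Suc l) (w @ u) = v l"
          show False
          proof (cases "l < k")
            case True
            then show False using arg_cong[OF eq, of "\<lambda>u. u ! l"] x
              by (auto simp: v_def w_def nth_append simp del: replicate.simps take_Suc_Cons)
          next
            case False
            then show False using arg_cong[OF eq, of "\<lambda>u. u ! k"] x \<open>k \<noteq> l\<close>
              by (auto simp: v_def w_def nth_append)
          qed
        qed
        then have "t l (w @ u) = w @ u"
          unfolding t_def by (intro extend_trivial[OF wu]) simp
        moreover have "replicate N z @ u \<in> lists X" using u z_in by auto
        then have "t k (w @ u) = w @ spinal z b u"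
          using extend_append[OF vX, of "replicate N z @ u" k] vX[of k]
          by (simp add: t_def w_def level_def)
        ultimately show ?thesis
          using mult_tree_Aut[OF germ_group_aut[OF a] germ_group_aut[OF t] wu] tk by simp
      qed
      note aw = this
      obtain c where c: "c \<in> C" and ac: "\<And>u. u \<in> lists X \<Longrightarrow> a (w @ u) = a w @ spinal z c u"
        using SF w unfolding spinal_from_def by blast
      have "a w = w" using aw[of "[]"] by simp
      then have "spinal z c [y] = spinal z b [y]" if "y \<in> X" for y
        using ac[of "[y]"] aw[of "[y]"] that by simp
      then have "c y = b y" if "y \<in> X - {z}" for y using that by (metis DiffE list.inject singletonI spinal.simps(2))
      moreover have "c permutes X - {z}" using C c by (auto simp: perm_group_def)
      ultimately have "c = b" using bp by (metis ext permutes_not_in)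
      then show False using b c by simp
    qed
  qed
qed

section \<open>Maximality\<close>

text \<open>The hypothesis \<open>self_norm\<close> says that \<open>C\<close> is its own normaliser in \<open>B\<close>, in the form in which it is
  applied to the coordinate \<open>\<beta> v\<close>.\<close>

theorem germ_group_maximal:
  assumes B: "perm_group (X - {z}) B" and C: "perm_group (X - {z}) C" and CB: "C \<subset> B"
    and max: "\<And>K. perm_group (X - {z}) K \<Longrightarrow> C \<subseteq> K \<Longrightarrow> K \<subseteq> B \<Longrightarrow> K = C \<or> K = B"
    and self_norm: "\<And>b. b \<in> B - C \<Longrightarrow> \<exists>c\<in>C. b \<circ> c \<circ> Hilbert_Choice.inv b \<notin> C"
  shows "maximal_subgroup (\<G> C) (sub_Aut X (\<G> B))"
proof -
  interpret T: group "tree_Aut X" by (rule group_tree_Aut)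
  have idB: "id \<in> B" "id \<in> C" using B C by (auto simp: perm_group_def)
  have compB: "\<And>b c. b \<in> B \<Longrightarrow> c \<in> B \<Longrightarrow> b \<circ> c \<in> B"
    and invB: "\<And>b. b \<in> B \<Longrightarrow> Hilbert_Choice.inv b \<in> B"
    using B by (auto simp: perm_group_def)
  have inv_id: "b \<circ> Hilbert_Choice.inv b = id" "Hilbert_Choice.inv b \<circ> b = id" if "b \<in> B" for b
    using permutes_inv_o[OF permE(4)[OF B that]] by auto
  have sub: "subgroup (\<G> C) (sub_Aut X (\<G> B))"
    using subgroup_sub_Aut subgroup_germ_group B C germ_group_mono CB by blast
  have "\<G> B \<subseteq> H"
    if HB: "subgroup H (sub_Aut X (\<G> B))" and CH: "\<G> C \<subseteq> H" and ne: "H \<noteq> \<G> C" for H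
  proof
    have H: "subgroup H (tree_Aut X)"
      using T.incl_subgroup[OF subgroup_germ_group[OF B] HB] .
    have HsubB: "H \<subseteq> \<G> B" using subgroup.subset[OF HB] by simp
    have H_aut: "a \<in> tree_aut X" if "a \<in> H" for a using that HsubB germ_group_aut by auto
    have cancel_left: "x \<in> H" if "a \<in> H" "a \<otimes>\<^bsub>tree_Aut X\<^esub> x \<in> H" "x \<in> tree_aut X" for a x
      using subgroup.m_closed[OF H subgroup.m_inv_closed[OF H that(1)] that(2)]
        T.inv_solve_left[of x a "a \<otimes>\<^bsub>tree_Aut X\<^esub> x"] that H_aut by simp
    have cancel_right: "x \<in> H" if "a \<in> H" "x \<otimes>\<^bsub>tree_Aut X\<^esub> a \<in> H" "x \<in> tree_aut X" for a x
      using subgroup.m_closed[OF H that(2) subgroup.m_inv_closed[OF H that(1)]]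
        T.inv_solve_right[of x "x \<otimes>\<^bsub>tree_Aut X\<^esub> a" a] that H_aut by simp
    obtain h where h: "h \<in> H" "h \<notin> \<G> C" using CH ne by blast
    fix g assume g: "g \<in> \<G> B"
    have ga: "g \<in> tree_aut X" and ha: "h \<in> tree_aut X" using g h HsubB germ_group_aut by auto
    obtain N N' where "SF B N g" "SF B N' h" using g h HsubB by (auto simp: germ_group_def)
    then have "SF B (max N N') g" "SF B (max N N') h" using spinal_from_mono[OF idB(1)] by auto
    \<comment> \<open>A common level for \<open>g\<close> and \<open>h\<close>, so that everything takes place in one power of \<open>B\<close>.\<close>
    then obtain M where SFg: "SF B M g" and SFh: "SF B M h" by blast
    obtain \<gamma> where \<gamma>: "\<And>w. w \<in> level X M \<Longrightarrow> \<gamma> w \<in> B" and g_eq: "g = E M g \<gamma>"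
      using spinal_from_extend[OF ga SFg] by blast
    obtain \<beta> where \<beta>: "\<And>w. w \<in> level X M \<Longrightarrow> \<beta> w \<in> B" and h_eq: "h = E M h \<beta>"
      using spinal_from_extend[OF ha SFh] by blast
    obtain v where v: "v \<in> level X M" and bv: "\<beta> v \<in> B - C"
      using extend_in[OF C ha, of M \<beta>] h(2) h_eq \<beta> by auto

    let ?one = "\<lambda>u\<in>lists X. u"
    \<comment> \<open>\<open>D\<close> embeds the direct power of \<open>B\<close> indexed by level \<open>M\<close>; \<open>s w\<close> is the factor at \<open>w\<close>.\<close>
    define D where "D \<delta> = E M ?one \<delta>" for \<delta>
    define s where "s w b = D ((\<lambda>_. id)(w := b))" for w b
    have D_aut: "D \<delta> \<in> tree_aut X" if "\<And>w. w \<in> level X M \<Longrightarrow> \<delta> w \<in> B" for \<delta>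
      unfolding D_def using germ_group_aut[OF extend_in[OF B one_tree_aut]] that by blast
    have D_mult: "D \<delta> \<otimes>\<^bsub>tree_Aut X\<^esub> D \<epsilon> = D \<eta>"
      if "\<And>w. w \<in> level X M \<Longrightarrow> \<delta> w \<in> B" "\<And>w. w \<in> level X M \<Longrightarrow> \<epsilon> w \<in> B"
        "\<And>w. w \<in> level X M \<Longrightarrow> \<delta> w \<circ> \<epsilon> w = \<eta> w" for \<delta> \<epsilon> \<eta>
    proof -
      have "?one \<otimes>\<^bsub>tree_Aut X\<^esub> ?one = ?one" using one_mult_tree_Aut one_tree_aut by blast
      then have "D \<delta> \<otimes>\<^bsub>tree_Aut X\<^esub> D \<epsilon> = E M ?one (\<lambda>w. \<delta> (?one w) \<circ> \<epsilon> w)"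
        unfolding D_def using extend_mult[OF B one_tree_aut one_tree_aut, of M \<delta> \<epsilon>] that by simp
      also have "\<dots> = D \<eta>" unfolding D_def
        by (rule extend_cong) (use that(3) in \<open>auto simp: level_def\<close>)
      finally show ?thesis .
    qed
    have s_aut: "s w b \<in> tree_aut X" if "b \<in> B" for w b
      unfolding s_def using D_aut that idB by auto
    have rooted: "E M a (\<lambda>_. id) \<in> H" "E M a (\<lambda>_. id) \<in> tree_aut X" if "a \<in> tree_aut X" for a
      using extend_in[OF C that, of M "\<lambda>_. id"] idB CH germ_group_aut by auto
    have split: "E M a \<delta> = E M a (\<lambda>_. id) \<otimes>\<^bsub>tree_Aut X\<^esub> D \<delta>"
      if "a \<in> tree_aut X" "\<And>w. w \<in> level X M \<Longrightarrow> \<delta> w \<in> B" for a \<delta>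
      unfolding D_def using extend_mult[OF B that(1) one_tree_aut, of M "\<lambda>_. id" \<delta>] that idB
        one_mult_tree_Aut[of a] by simp

    have D\<beta>: "D \<beta> \<in> H"
      using cancel_left[OF rooted(1)[OF ha] _ D_aut] split[OF ha] \<beta> h h_eq by simp
    define K where "K = {b \<in> B. s v b \<in> H}"
    have s_mult: "s v b \<otimes>\<^bsub>tree_Aut X\<^esub> s v c = s v (b \<circ> c)" if "b \<in> B" "c \<in> B" for b c
      unfolding s_def by (rule D_mult) (use that idB in auto)
    have s_id: "s v id \<in> H"
      using rooted(1)[OF one_tree_aut] by (simp add: s_def D_def fun_upd_idem)
    have "perm_group (X - {z}) K"
      unfolding perm_group_def
    proof (intro conjI ballI)
      show "b permutes X - {z}" if "b \<in> K" for b using that B by (auto simp: K_def perm_group_def)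
      show "id \<in> K" using idB s_id by (simp add: K_def)
      show "b \<circ> c \<in> K" if "b \<in> K" "c \<in> K" for b c
        using that subgroup.m_closed[OF H, of "s v b" "s v c"] s_mult[of b c] compB
        by (auto simp: K_def)
      show "Hilbert_Choice.inv b \<in> K" if "b \<in> K" for b
      proof -
        have b: "b \<in> B" "s v b \<in> H" using that by (auto simp: K_def)
        then show ?thesis
          using cancel_right[OF b(2) _ s_aut] s_mult[OF invB b(1)] s_id inv_id invB
          by (simp add: K_def)
      qed
    qed
    moreover have "C \<subseteq> K"
    proof
      fix c assume "c \<in> C"
      then show "c \<in> K"
        using extend_in[OF C one_tree_aut, of M "(\<lambda>_. id)(v := c)"] idB CH CB
        by (auto simp: K_def s_def D_def)
    qed
    moreover have "K \<noteq> C"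
    proof -
      obtain c where c: "c \<in> C" and e: "\<beta> v \<circ> c \<circ> Hilbert_Choice.inv (\<beta> v) \<notin> C"
        using self_norm[OF bv] by blast
      let ?e = "\<beta> v \<circ> c \<circ> Hilbert_Choice.inv (\<beta> v)"
      have bB: "\<beta> v \<in> B" and cB: "c \<in> B" using bv c CB by auto
      then have eB: "?e \<in> B" using compB invB by blast
      have e\<beta>: "?e \<circ> \<beta> v = \<beta> v \<circ> c" using inv_id[OF bB] by (metis comp_assoc comp_id)
      \<comment> \<open>Both sides of \<open>s v ?e * D \<beta> = D \<beta> * s v c\<close> equal \<open>D \<eta>\<close>: away from \<open>v\<close> the conjugation by
        \<open>\<beta>\<close> is not seen.\<close>
      define \<eta> where "\<eta> w = (if w = v then \<beta> v \<circ> c else \<beta> w)" for w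
      have "s v ?e \<otimes>\<^bsub>tree_Aut X\<^esub> D \<beta> = D \<eta>"
        unfolding s_def by (rule D_mult) (use eB idB \<beta> e\<beta> in \<open>auto simp: \<eta>_def\<close>)
      also have "D \<eta> = D \<beta> \<otimes>\<^bsub>tree_Aut X\<^esub> s v c"
        unfolding s_def by (rule D_mult[symmetric]) (use cB idB \<beta> in \<open>auto simp: \<eta>_def\<close>)
      also have "\<dots> \<in> H" using D\<beta> c \<open>C \<subseteq> K\<close> subgroup.m_closed[OF H] by (auto simp: K_def)
      finally have "s v ?e \<in> H" using cancel_right[OF D\<beta> _ s_aut[OF eB]] by blast
      then show ?thesis using e eB by (auto simp: K_def)
    qed
    ultimately have "K = B" using max[of K] by (auto simp: K_def)
    \<comment> \<open>Conjugation by a finitary automorphism taking \<open>v\<close> to \<open>w\<close>.\<close>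
    have s_in: "s w b \<in> H" if w: "w \<in> level X M" and b: "b \<in> B" for w b
    proof -
      obtain a where a: "a \<in> tree_aut X" "a v = w"
        using tree_aut_transitive[OF finite_X v w] by blast
      have inj: "a u = w \<longleftrightarrow> u = v" if "u \<in> level X M" for u
        using inv_tree_Aut(2)[OF a(1)] a(2) that v by (metis (no_types, lifting) level_def mem_Collect_eq)
      let ?r = "E M a (\<lambda>_. id)"
      have "s w b \<otimes>\<^bsub>tree_Aut X\<^esub> ?r = E M a (\<lambda>u. ((\<lambda>_. id)(w := b)) (a u) \<circ> id)"
        unfolding s_def D_def
        using extend_mult[OF B one_tree_aut a(1), of M "(\<lambda>_. id)(w := b)" "\<lambda>_. id"] b idB
          one_mult_tree_Aut[of a] a by simp
      also have "\<dots> = E M a ((\<lambda>_. id)(v := b))"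
        by (rule extend_cong) (use inj in auto)
      also have "\<dots> = ?r \<otimes>\<^bsub>tree_Aut X\<^esub> s v b"
        unfolding s_def by (rule split[OF a(1)]) (use b idB in auto)
      also have "\<dots> \<in> H"
        using subgroup.m_closed[OF H] rooted(1)[OF a(1)] b \<open>K = B\<close> by (auto simp: K_def)
      finally show ?thesis using cancel_right[OF rooted(1)[OF a(1)] _ s_aut[OF b]] by blast
    qed
    have "D (\<lambda>w. if w \<in> S then \<gamma> w else id) \<in> H" if "S \<subseteq> level X M" for S
      using finite_subset[OF that finite_level[OF finite_X]] that
    proof (induction S rule: finite_induct)
      case empty
      then show ?case using rooted(1)[OF one_tree_aut] unfolding D_def by (simp only: empty_iff if_False)
    next
      case (insert w S)
      have "D (\<lambda>u. if u \<in> S then \<gamma> u else id) \<otimes>\<^bsub>tree_Aut X\<^esub> s w (\<gamma> w)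
          = D (\<lambda>u. if u \<in> insert w S then \<gamma> u else id)"
        unfolding s_def by (rule D_mult) (use insert \<gamma> idB in auto)
      then show ?case
        using subgroup.m_closed[OF H insert.IH s_in[of w "\<gamma> w"]] insert.prems \<gamma> by auto
    qed
    from this[of "level X M"] have "D (\<lambda>w. if w \<in> level X M then \<gamma> w else id) \<in> H" by simp
    moreover have "D (\<lambda>w. if w \<in> level X M then \<gamma> w else id) = D \<gamma>"
      unfolding D_def by (rule extend_cong) simp
    ultimately have "E M g (\<lambda>_. id) \<otimes>\<^bsub>tree_Aut X\<^esub> D \<gamma> \<in> H"
      using subgroup.m_closed[OF H rooted(1)[OF ga]] by simp
    moreover have "g = E M g (\<lambda>_. id) \<otimes>\<^bsub>tree_Aut X\<^esub> D \<gamma>"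
      using split[of g \<gamma>] ga \<gamma> g_eq by simp
    ultimately show "g \<in> H" by metis
  qed
  moreover have "\<G> C \<noteq> \<G> B"
  proof
    assume eq: "\<G> C = \<G> B"
    have "finite_index (\<G> B) (sub_Aut X (\<G> B))"
      using finite_index_carrier[OF group_sub_germ[OF B]] by simp
    then show False using germ_group_infinite_index[OF B C CB] eq by simp
  qed
  ultimately show ?thesis
    using sub subgroup.subset[of _ "sub_Aut X (\<G> B)"]
    unfolding maximal_subgroup_def by fastforce
qed

end

section \<open>Point stabilisers in symmetric groups\<close>

lemma perm_group_Sym: "S \<subseteq> T \<Longrightarrow> perm_group T {c. c permutes S}"
  unfolding perm_group_def
  by (auto intro: permutes_subset permutes_id permutes_compose permutes_inv)

text \<open>An element \<open>b\<close> of \<open>K\<close> moving \<open>a\<close> yields every other permutation \<open>d\<close> moving \<open>a\<close>: following \<open>b\<close>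
  by a permutation of \<open>S\<close> that takes \<open>b a\<close> to \<open>d a\<close> gives an element of \<open>d Sym(S)\<close>.\<close>

lemma Sym_maximal:
  assumes K: "perm_group T K" and le: "{c. c permutes S} \<subseteq> K" "K \<subseteq> {c. c permutes insert a S}"
    and a: "a \<notin> S"
  shows "K = {c. c permutes S} \<or> K = {c. c permutes insert a S}"
proof (rule disjCI)
  have fixes_a: "c permutes S" if "c permutes insert a S" "c a = a" for c
    using permutes_superset[OF that(1), of S] that(2) by auto
  assume "K \<noteq> {c. c permutes insert a S}"
  then obtain d where d: "d permutes insert a S" "d \<notin> K" using le by blast
  have "b permutes S" if b: "b \<in> K" for b
  proof (rule ccontr)
    assume nb: "\<not> b permutes S"
    have bp: "b permutes insert a S" using b le by blast
    have ba: "b a \<in> S" using nb bp fixes_a permutes_in_image[OF bp, of a] by auto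
    have "d a \<noteq> a" using fixes_a[OF d(1)] d le by blast
    then have da: "d a \<in> S" using permutes_in_image[OF d(1), of a] by auto
    define c where "c = transpose (d a) (b a) \<circ> b"
    have "transpose (d a) (b a) \<in> K" using le(1) permutes_swap_id[OF da ba] by blast
    then have c: "c \<in> K" using K b by (auto simp: c_def perm_group_def)
    have cp: "c permutes insert a S" using c le by blast
    have "c a = d a" by (simp add: c_def)
    then have "(Hilbert_Choice.inv c \<circ> d) a = a" using permutes_inverses(2)[OF cp, of a] by simp
    then have "Hilbert_Choice.inv c \<circ> d \<in> K"
      using fixes_a[OF permutes_compose[OF d(1) permutes_inv[OF cp]]] le by blast
    then have "c \<circ> (Hilbert_Choice.inv c \<circ> d) \<in> K" using K c by (auto simp: perm_group_def)
    then show False using d permutes_inv_o(1)[OF cp] by (simp add: comp_assoc[symmetric])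
  qed
  then show "K = {c. c permutes S}" using le by blast
qed

text \<open>The conjugate by \<open>b\<close> of the symmetric group on \<open>S\<close> fixes \<open>b a \<noteq> a\<close> only, so it moves \<open>a\<close>; two points
  of \<open>S\<close> are what makes this true.\<close>

lemma Sym_self_normalising:
  assumes b: "b permutes insert a S" "\<not> b permutes S" and a: "a \<notin> S"
    and S: "x \<in> S" "y \<in> S" "x \<noteq> y"
  shows "\<exists>c. c permutes S \<and> \<not> b \<circ> c \<circ> Hilbert_Choice.inv b permutes S"
proof -
  let ?d = "Hilbert_Choice.inv b a"
  have ba: "b a \<noteq> a" using permutes_superset[OF b(1), of S] b(2) by auto
  have bd: "b ?d = a" using permutes_inverses(1)[OF b(1)] .
  then have "?d \<noteq> a" using ba by auto
  then have d: "?d \<in> S" using permutes_in_image[OF permutes_inv[OF b(1)], of a] by auto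
  obtain e where e: "e \<in> S" "e \<noteq> ?d" using S by blast
  let ?c = "transpose ?d e"
  have "(b \<circ> ?c \<circ> Hilbert_Choice.inv b) a = b e" by simp
  also have "b e \<noteq> a" using bd e permutes_inj[OF b(1)] by (metis injD)
  finally have "\<not> b \<circ> ?c \<circ> Hilbert_Choice.inv b permutes S"
    using a permutes_not_in by metis
  then show ?thesis using permutes_swap_id[OF d e(1)] by blast
qed

theorem mainTheorem5:
  fixes n :: nat
  shows "\<exists>(X :: nat set) (G :: (nat list \<Rightarrow> nat list) set)
           (Gs :: nat \<Rightarrow> (nat list \<Rightarrow> nat list) set).
    finite X \<and> X \<noteq> {} \<and> branch_group X G \<and>
    (\<forall>i\<le>n. subgroup (Gs i) (sub_Aut X G)) \<and> (\<forall>i\<in>{1..n}. Gs (i - 1) \<subseteq> Gs i) \<and> Gs n = G \<and>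
    (\<forall>i\<in>{1..n}. branch_group X (Gs (i - 1)) \<and>
       maximal_subgroup (Gs (i - 1)) (sub_Aut X (Gs i)) \<and>
       \<not> finite_index (Gs (i - 1)) (sub_Aut X (Gs i)))"
proof -
  define X :: "nat set" where "X = {0..n + 2}"
  define C :: "nat \<Rightarrow> (nat \<Rightarrow> nat) set" where "C i = {c. c permutes {1..i + 2}}" for i
  interpret marked_alphabet X 0 by unfold_locales (auto simp: X_def)
  have C: "perm_group (X - {0}) (C i)" if "i \<le> n" for i
    unfolding C_def using that by (intro perm_group_Sym) (auto simp: X_def)
  have C_mono: "C i \<subseteq> C j" if "i \<le> j" for i j
    unfolding C_def using that by (auto elim!: permutes_subset)
  have step: "maximal_subgroup (\<G> (C (i - 1))) (sub_Aut X (\<G> (C i))) \<and>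
      \<not> finite_index (\<G> (C (i - 1))) (sub_Aut X (\<G> (C i)))" if i: "i \<in> {1..n}" for i
  proof -
    let ?S = "{1..i + 1}" and ?a = "i + 2"
    have ins: "insert ?a ?S = {1..i + 2}" and pre: "{1..i - 1 + 2} = ?S" using i by auto
    have Ci: "C i = {c. c permutes insert ?a ?S}" and Ci': "C (i - 1) = {c. c permutes ?S}"
      unfolding C_def ins pre by auto
    have P: "perm_group (X - {0}) (C i)" "perm_group (X - {0}) (C (i - 1))" using C i by auto
    have "transpose 1 ?a \<in> C i" unfolding Ci by (auto intro: permutes_swap_id)
    moreover have "transpose 1 ?a \<notin> C (i - 1)"
    proof
      assume "transpose 1 ?a \<in> C (i - 1)"
      then have "transpose 1 ?a ?a = ?a" unfolding Ci' by (intro permutes_not_in) auto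
      then show False by simp
    qed
    ultimately have lt: "C (i - 1) \<subset> C i" using C_mono[of "i - 1" i] by auto
    have "maximal_subgroup (\<G> (C (i - 1))) (sub_Aut X (\<G> (C i)))"
    proof (rule germ_group_maximal[OF P lt])
      show "K = C (i - 1) \<or> K = C i"
        if "perm_group (X - {0}) K" "C (i - 1) \<subseteq> K" "K \<subseteq> C i" for K
        using Sym_maximal[OF that[unfolded Ci Ci']] unfolding Ci Ci' by auto
      show "\<exists>c\<in>C (i - 1). b \<circ> c \<circ> Hilbert_Choice.inv b \<notin> C (i - 1)" if "b \<in> C i - C (i - 1)" for b
        using Sym_self_normalising[of b ?a ?S 1 2] that i unfolding Ci Ci' by auto
    qed
    then show ?thesis using germ_group_infinite_index[OF P lt] by blast
  qed
  have mono: "\<G> (C i) \<subseteq> \<G> (C j)" if "i \<le> j" for i j using germ_group_mono C_mono[OF that] .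
  have sub: "subgroup (\<G> (C i)) (sub_Aut X (\<G> (C n)))" if "i \<le> n" for i
    using subgroup_sub_Aut[OF subgroup_germ_group subgroup_germ_group mono] C that by blast
  show ?thesis
    by (rule exI[of _ X], rule exI[of _ "\<G> (C n)"], rule exI[of _ "\<lambda>i. \<G> (C i)"])
      (use step sub mono C branch_germ_group in \<open>auto simp: X_def\<close>)
qed

end
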